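(* Let $\mathcal{P}$ be a finite index set, $\{A_p : p\in\mathcal{P}\}$ a collection of real $n\times n$ matrices, each either stable or unstable, and $\mathcal{I}=\{I_q : q\in\mathcal{Q}\}$ a nonempty compact set of nonzero real $n\times n$ matrices. Let $\mathcal{G}$ be a directed graph on the subsystems such that its subgraph $\mathcal{G}_u$ is acyclic. For each $p\in\mathcal{P}$ fix a complex Jordan decomposition $A_p=P_pJ_pP_p^{-1}$ and constants $c_p>0$ and $\lambda_p^*>0$ (if $A_p$ is stable) or $\mu_p^*>0$ (if $A_p$ is unstable) such that, for all $t>0$, $\|e^{J_pt}\|\le c_pe^{-\lambda_p^*t}$ if $A_p$ is stable and $\|e^{J_pt}\|\le c_pe^{\mu_p^*t}$ if $A_p$ is unstable. Set $$\tau_I=\max_{(p,q)\in\mathcal{E}(\mathcal{G}_s)}\max_{M\in\mathcal{I}}\frac{\ln\left(c_p\,\|P_q^{-1}MP_p\|\right)}{\lambda_p^*},\qquad \eta_I=-\max_{(p,q)\in\mathcal{E}(\mathcal{G}_u)}\max_{M\in\mathcal{I}}\frac{\ln\left(c_p\,\|P_q^{-1}MP_p\|\right)}{\mu_p^*}.$$ Then for all switching signals $\sigma\in\mathcal{S}^{\mathcal{G}}[\tau_I,\eta_I]$ the impulsive switched system $\dot x(t)=A_{\sigma(t)}x(t)$, $x(t_k)=I_{\omega(t_k)}\,x(t_k^-)$ ($k\ge1$) is stable under arbitrary impulses, i.e. stable for every function $\omega:\{t_1,t_2,\dots\}\to\mathcal{Q}$.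
   Context: A real matrix is called stable if all its eigenvalues have negative real part, and unstable if at least one eigenvalue has positive real part. $\|\cdot\|$ is the Euclidean norm for vectors and the spectral norm for matrices. A switching signal is a right-continuous piecewise constant function $\sigma:[0,\infty)\to\mathcal{P}$ whose set of discontinuities $\{t_k\}_{k\ge1}$ (switching times) is an increasing sequence with $t_k\uparrow\infty$; put $t_0=0$. Graph: $\mathcal{G}$ is a directed graph with vertices the subsystems $A_p$, identified with $p\in\mathcal{P}$, such that every $p$ has at least one outgoing edge $(p,q)\in\mathcal{E}(\mathcal{G})$. $\mathcal{G}_s$ and $\mathcal{G}_u$ are the subgraphs with the same vertices and with edges $\mathcal{E}(\mathcal{G}_s)=\{(p,q)\in\mathcal{E}(\mathcal{G}) : A_p \text{ stable}\}$, $\mathcal{E}(\mathcal{G}_u)=\{(p,q)\in\mathcal{E}(\mathcal{G}) : A_p \text{ unstable}\}$. A signal $\sigma$ is $\mathcal{G}$-admissible if $(\sigma(t_{k-1}),\sigma(t_k))\in\mathcal{E}(\mathcal{G})$ for all $k\ge1$. $\mathcal{S}^{\mathcal{G}}[\tau,\eta]$ is the set of $\mathcal{G}$-admissible switching signals such that for all $k\ge1$: $t_k-t_{k-1}\ge\tau$ if $A_{\sigma(t_{k-1})}$ is stable, and $t_k-t_{k-1}\le\eta$ if $A_{\sigma(t_{k-1})}$ is unstable (if there are no stable, resp. no unstable, subsystems, the constraint involving $\tau$, resp. $\eta$, is absent). In the impulsive switched system, $\dot x=A_{\sigma(t)}x$ holds on each $[t_{k-1},t_k)$ and $x(t_k^-)=\lim_{t\to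 t_k^-}x(t)$. The system (for fixed $\sigma,\omega$) is stable if for every $\epsilon>0$ there is $\delta>0$ such that $\|x(0)\|<\delta$ implies $\|x(t)\|<\epsilon$ for all $t>0$. *)

theory Defs
  imports
    "Jordan_Normal_Form.Jordan_Normal_Form"
    "HOL-Analysis.Analysis"
begin

(* Matrices are those of HOL-Analysis; from Jordan_Normal_Form only jordan_matrix is used. *)
no_notation vec_index (infixl \<open>$\<close> 100)
no_notation scalar_prod (infix \<open>\<bullet>\<close> 70)
hide_const (open) Matrix.vec Matrix.mat Matrix.row Matrix.col Determinant.det

section \<open>Matrices\<close>

abbreviation complex_matrix :: "real^'n^'m \<Rightarrow> complex^'n^'m" where
  "complex_matrix \<equiv> map_matrix complex_of_real"

(* The library norm on matrices is the Frobenius norm, hence the explicit operator norm. *)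
definition spectral_norm :: "('a::real_normed_field)^'n^'m \<Rightarrow> real" where
  "spectral_norm M = onorm (\<lambda>x. M *v x)"

definition eigenvalues :: "real^'n^'n \<Rightarrow> complex set" where
  "eigenvalues A = {l. \<exists>v. v \<noteq> 0 \<and> complex_matrix A *v v = l *s v}"

definition stable_matrix :: "real^'n^'n \<Rightarrow> bool" where
  "stable_matrix A \<longleftrightarrow> (\<forall>l\<in>eigenvalues A. Re l < 0)"

definition unstable_matrix :: "real^'n^'n \<Rightarrow> bool" where
  "unstable_matrix A \<longleftrightarrow> (\<exists>l\<in>eigenvalues A. Re l > 0)"

primrec matrix_power :: "('a::semiring_1)^'n^'n \<Rightarrow> nat \<Rightarrow> 'a^'n^'n" where
  "matrix_power A 0 = mat 1"
| "matrix_power A (Suc k) = A ** matrix_power A k"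

definition matrix_exp :: "('a::real_normed_field)^'n^'n \<Rightarrow> 'a^'n^'n" where
  "matrix_exp A = (\<Sum>k. (1 / fact k) *\<^sub>R matrix_power A k)"

(* The index type 'n carries no order, so the block structure refers to some enumeration e of it. *)
definition is_jordan_matrix :: "complex^'n^'n \<Rightarrow> bool" where
  "is_jordan_matrix J \<longleftrightarrow>
     (\<exists>n_as (e :: nat \<Rightarrow> 'n).
        0 \<notin> fst ` set n_as \<and> sum_list (map fst n_as) = CARD('n) \<and>
        bij_betw e {..<CARD('n)} UNIV \<and>
        (\<forall>i<CARD('n). \<forall>j<CARD('n). J $ e i $ e j = jordan_matrix n_as $$ (i, j)))"

definition jordan_decomposition :: "real^'n^'n \<Rightarrow> complex^'n^'n \<Rightarrow> complex^'n^'n \<Rightarrow> bool" where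
  "jordan_decomposition A P J \<longleftrightarrow>
     is_jordan_matrix J \<and> invertible P \<and> complex_matrix A = P ** J ** matrix_inv P"


section \<open>Switching signals\<close>

(* Vertices are the indices in V; loops are allowed in E, although a switching signal never
   traverses one, its values before and at a switching time being different. *)
definition subsystem_graph :: "'p set \<Rightarrow> ('p \<times> 'p) set \<Rightarrow> bool" where
  "subsystem_graph V E \<longleftrightarrow> E \<subseteq> V \<times> V \<and> (\<forall>p\<in>V. \<exists>q. (p, q) \<in> E)"

definition stable_edges :: "('p \<Rightarrow> real^'n^'n) \<Rightarrow> ('p \<times> 'p) set \<Rightarrow> ('p \<times> 'p) set" where
  "stable_edges A E = {(p, q) \<in> E. stable_matrix (A p)}"

definition unstable_edges :: "('p \<Rightarrow> real^'n^'n) \<Rightarrow> ('p \<times> 'p) set \<Rightarrow> ('p \<times> 'p) set" where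
  "unstable_edges A E = {(p, q) \<in> E. unstable_matrix (A p)}"

(* Signals live on [0, \<infinity>) and take values in a discrete set, so continuity at s means being
   locally constant at s. The sequence t is determined by \<sigma>: t 0 = 0, and t 1, t 2, ... are the
   discontinuities in increasing order. *)
definition switching_signal :: "'p set \<Rightarrow> (real \<Rightarrow> 'p) \<Rightarrow> (nat \<Rightarrow> real) \<Rightarrow> bool" where
  "switching_signal V \<sigma> t \<longleftrightarrow>
     (\<forall>s\<ge>0. \<sigma> s \<in> V) \<and>
     t 0 = 0 \<and> strict_mono t \<and> filterlim t at_top sequentially \<and>
     (\<forall>s\<ge>0. \<forall>\<^sub>F r in at_right s. \<sigma> r = \<sigma> s) \<and>
     (\<forall>k. \<sigma> constant_on {t k<..<t (Suc k)}) \<and>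
     {s. 0 \<le> s \<and> \<not> (\<forall>\<^sub>F r in at s within {0..}. \<sigma> r = \<sigma> s)} = t ` {1..}"

definition admissible :: "('p \<times> 'p) set \<Rightarrow> (real \<Rightarrow> 'p) \<Rightarrow> (nat \<Rightarrow> real) \<Rightarrow> bool" where
  "admissible E \<sigma> t \<longleftrightarrow> (\<forall>k\<ge>1. (\<sigma> (t (k - 1)), \<sigma> (t k)) \<in> E)"

(* Signals are paired with their switching times. If there is no stable (unstable) subsystem,
   the constraint involving \<tau> (\<eta>) is vacuous. *)
definition dwell_flee_signals ::
  "'p set \<Rightarrow> ('p \<Rightarrow> real^'n^'n) \<Rightarrow> ('p \<times> 'p) set \<Rightarrow> real \<Rightarrow> real \<Rightarrow>
     ((real \<Rightarrow> 'p) \<times> (nat \<Rightarrow> real)) set" where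
  "dwell_flee_signals V A E \<tau> \<eta> =
     {(\<sigma>, t). switching_signal V \<sigma> t \<and> admissible E \<sigma> t \<and>
        (\<forall>k\<ge>1. (stable_matrix (A (\<sigma> (t (k - 1)))) \<longrightarrow> t k - t (k - 1) \<ge> \<tau>) \<and>
                (unstable_matrix (A (\<sigma> (t (k - 1)))) \<longrightarrow> t k - t (k - 1) \<le> \<eta>))}"


section \<open>Impulsive switched systems\<close>

definition impulsive_solution ::
  "('p \<Rightarrow> real^'n^'n) \<Rightarrow> ('q \<Rightarrow> real^'n^'n) \<Rightarrow> (real \<Rightarrow> 'p) \<Rightarrow> (nat \<Rightarrow> real) \<Rightarrow> (real \<Rightarrow> 'q) \<Rightarrow>
     (real \<Rightarrow> real^'n) \<Rightarrow> bool" where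
  "impulsive_solution A I \<sigma> t \<omega> x \<longleftrightarrow>
     (\<forall>k\<ge>1. \<forall>s\<in>{t (k - 1)..<t k}.
        (x has_vector_derivative A (\<sigma> s) *v x s) (at s within {t (k - 1)..<t k})) \<and>
     (\<forall>k\<ge>1. \<exists>l. (x \<longlongrightarrow> l) (at_left (t k)) \<and> x (t k) = I (\<omega> (t k)) *v l)"

definition impulsive_stable ::
  "('p \<Rightarrow> real^'n^'n) \<Rightarrow> ('q \<Rightarrow> real^'n^'n) \<Rightarrow> (real \<Rightarrow> 'p) \<Rightarrow> (nat \<Rightarrow> real) \<Rightarrow> (real \<Rightarrow> 'q) \<Rightarrow> bool" where
  "impulsive_stable A I \<sigma> t \<omega> \<longleftrightarrow>
     (\<forall>\<epsilon>>0. \<exists>\<delta>>0. \<forall>x. impulsive_solution A I \<sigma> t \<omega> x \<longrightarrow> norm (x 0) < \<delta> \<longrightarrow>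
        (\<forall>s>0. norm (x s) < \<epsilon>))"

(* The suprema are maxima when \<M> is a nonempty compact set of nonzero matrices and each P p is
   invertible. Max over an empty edge set is unspecified; the bound is then not used. *)
definition tau_bound ::
  "('p \<Rightarrow> real^'n^'n) \<Rightarrow> ('p \<times> 'p) set \<Rightarrow> (real^'n^'n) set \<Rightarrow> ('p \<Rightarrow> complex^'n^'n) \<Rightarrow>
     ('p \<Rightarrow> real) \<Rightarrow> ('p \<Rightarrow> real) \<Rightarrow> real" where
  "tau_bound A E \<M> P c lam =
     (MAX (p, q) \<in> stable_edges A E. SUP M\<in>\<M>.
        ln (c p * spectral_norm (matrix_inv (P q) ** complex_matrix M ** P p)) / lam p)"

definition eta_bound ::
  "('p \<Rightarrow> real^'n^'n) \<Rightarrow> ('p \<times> 'p) set \<Rightarrow> (real^'n^'n) set \<Rightarrow> ('p \<Rightarrow> complex^'n^'n) \<Rightarrow>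
     ('p \<Rightarrow> real) \<Rightarrow> ('p \<Rightarrow> real) \<Rightarrow> real" where
  "eta_bound A E \<M> P c mu =
     - (MAX (p, q) \<in> unstable_edges A E. SUP M\<in>\<M>.
        ln (c p * spectral_norm (matrix_inv (P q) ** complex_matrix M ** P p)) / mu p)"

end

theory Submission
  imports Defs
begin

text \<open>In the coordinates \<open>y = P\<^sub>p\<inverse> x\<close>, with \<open>p\<close> the active subsystem, the flow between two switching
  times is \<open>exp (J\<^sub>p s)\<close> and an impulse at a switch from \<open>p\<close> to \<open>q\<close> is \<open>P\<^sub>q\<inverse> M P\<^sub>p\<close>. The bounds on the
  dwell and flee times ensure that one interval followed by its impulse does not increase
  \<open>norm y\<close>, and within an interval \<open>norm y\<close> grows by at most a constant factor, because
  only the intervals with an unstable subsystem allow exponential growth and these have bounded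
  length.\<close>

section \<open>Matrices\<close>

abbreviation complex_vector :: "real^'n \<Rightarrow> complex^'n" where
  "complex_vector v \<equiv> (\<chi> i. complex_of_real (v $ i))"

lemma norm_complex_vector [simp]: "norm (complex_vector v) = norm v"
  by (simp add: norm_vec_def)

lemma bounded_linear_complex_vector: "bounded_linear complex_vector"
  by (rule bounded_linear_intro[where K = 1]) (auto simp: vec_eq_iff complex_eq_iff norm_vec_def)

lemma complex_vector_mult: "complex_vector (M *v v) = complex_matrix M *v complex_vector v"
  by (simp add: vec_eq_iff matrix_vector_mult_def)

lemma matrix_inv_left:
  assumes "invertible (P :: 'a::semiring_1^'n^'n)" shows "matrix_inv P ** P = mat 1"
  using assms unfolding invertible_def matrix_inv_def by (rule someI2_ex) simp

lemma matrix_inv_right: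
  assumes "invertible (P :: 'a::semiring_1^'n^'n)" shows "P ** matrix_inv P = mat 1"
  using assms unfolding invertible_def matrix_inv_def by (rule someI2_ex) simp

lemma bounded_bilinear_matrix_vector_mult:
  "bounded_bilinear (\<lambda>(M :: complex^'n^'m) v. M *v v)"
  unfolding bilinear_conv_bounded_bilinear[symmetric] bilinear_def
  by (auto intro!: linearI simp: vec_eq_iff matrix_vector_mult_def algebra_simps
      sum.distrib scaleR_sum_right)

lemma bounded_bilinear_matrix_matrix_mult:
  "bounded_bilinear (\<lambda>(M :: complex^'n^'m) (N :: complex^'k^'n). M ** N)"
  unfolding bilinear_conv_bounded_bilinear[symmetric] bilinear_def
  by (auto intro!: linearI simp: vec_eq_iff matrix_matrix_mult_def algebra_simps
      sum.distrib scaleR_sum_right)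

lemma bounded_linear_complex_matrix: "bounded_linear (complex_matrix :: real^'n^'m \<Rightarrow> _)"
  unfolding linear_conv_bounded_linear[symmetric]
  by (auto intro!: linearI simp: vec_eq_iff complex_eq_iff)

lemma norm_matrix_vector_le: "norm (M *v v) \<le> spectral_norm M * norm v"
  for M :: "complex^'n^'m"
  unfolding spectral_norm_def by (rule onorm) simp

lemma spectral_norm_nonneg [simp]: "0 \<le> spectral_norm M" for M :: "complex^'n^'m"
  unfolding spectral_norm_def by (rule onorm_pos_le) simp

text \<open>The product \<open>M *v v\<close> is bilinear in finite dimension, hence bounded, and
  its bilinear bound serves as one constant for all \<open>M\<close>. Boundedness in the library
  norm thus passes to the spectral norm.\<close>

lemma spectral_norm_le_norm:
  obtains K where "\<And>M :: complex^'n^'m. spectral_norm M \<le> K * norm M"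
proof -
  obtain K where K: "\<And>(M :: complex^'n^'m) v. norm (M *v v) \<le> norm M * norm v * K"
    using bounded_bilinear.bounded[OF bounded_bilinear_matrix_vector_mult] by blast
  have "spectral_norm M \<le> K * norm M" for M :: "complex^'n^'m"
    unfolding spectral_norm_def by (rule onorm_le) (use K[of M] in \<open>simp add: mult_ac\<close>)
  then show thesis ..
qed

text \<open>The map taking \<open>M\<close> to \<open>L ** complex_matrix M ** R\<close> is bounded
  linear. This bounds the jump matrices uniformly over the impulse set, so that the suprema in
  \<open>tau_bound\<close> and \<open>eta_bound\<close> are genuine least upper bounds.\<close>

lemma bounded_spectral_norm_conjugate:
  fixes \<M> :: "(real^'n^'m) set" and L :: "complex^'m^'m" and R :: "complex^'n^'n"
  assumes "bounded \<M>"
  obtains B where "\<And>M. M \<in> \<M> \<Longrightarrow> spectral_norm (L ** complex_matrix M ** R) \<le> B"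
proof -
  obtain K where K: "\<And>M :: complex^'n^'m. spectral_norm M \<le> K * norm M"
    using spectral_norm_le_norm by blast
  have "bounded_linear (\<lambda>M :: real^'n^'m. L ** complex_matrix M ** R)"
    by (intro bounded_linear_compose[OF bounded_bilinear.bounded_linear_left[OF bounded_bilinear_matrix_matrix_mult]]
        bounded_linear_compose[OF bounded_bilinear.bounded_linear_right[OF bounded_bilinear_matrix_matrix_mult]]
        bounded_linear_complex_matrix)
  from bounded_linear_image[OF assms this]
  obtain b where b: "\<And>M. M \<in> \<M> \<Longrightarrow> norm (L ** complex_matrix M ** R) \<le> b"
    unfolding bounded_iff by auto
  \<comment> \<open>The absolute value is taken because nothing is recorded about the sign of
    \<open>K\<close>.\<close>
  have "spectral_norm (L ** complex_matrix M ** R) \<le> \<bar>K\<bar> * b" if "M \<in> \<M>" for M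
    using K[of "L ** complex_matrix M ** R"] b[OF that]
    by (meson abs_ge_self abs_ge_zero mult_mono norm_ge_zero order_trans)
  then show thesis ..
qed


section \<open>The matrix exponential solves the linear differential equation\<close>

lemma matrix_power_scaleR:
  "matrix_power (r *\<^sub>R J) k = (r ^ k) *\<^sub>R matrix_power J k" for J :: "complex^'n^'n"
proof (induction k)
  case (Suc k)
  then show ?case
    by (simp add: bounded_bilinear.scaleR_left[OF bounded_bilinear_matrix_matrix_mult]
        bounded_bilinear.scaleR_right[OF bounded_bilinear_matrix_matrix_mult])
qed simp

text \<open>The constant \<open>K\<close> of the bounded bilinear product plays the part of
  submultiplicativity, so each further factor \<open>J\<close> costs at most
  \<open>norm J * K\<close>. Geometric growth is what the factorials in the exponential series and
  in the Taylor remainder dominate.\<close>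

lemma norm_matrix_power_le:
  fixes J :: "complex^'n^'n"
  obtains C B where "C \<ge> 0" "B \<ge> 0" "\<And>k. norm (matrix_power J k) \<le> C * B ^ k"
proof -
  obtain K where K: "K > 0" "\<And>(M :: complex^'n^'n) (N :: complex^'n^'n). norm (M ** N) \<le> norm M * norm N * K"
    using bounded_bilinear.pos_bounded[OF bounded_bilinear_matrix_matrix_mult] by blast
  have "norm (matrix_power J k) \<le> norm (mat 1 :: complex^'n^'n) * (norm J * K) ^ k" for k
  proof (induction k)
    case (Suc k)
    have "norm (matrix_power J (Suc k)) \<le> (norm J * K) * norm (matrix_power J k)"
      using K(2)[of J "matrix_power J k"] by (simp add: mult_ac)
    also have "\<dots> \<le> (norm J * K) * (norm (mat 1 :: complex^'n^'n) * (norm J * K) ^ k)"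
      by (rule mult_left_mono[OF Suc]) (use K(1) in simp)
    finally show ?case by (simp add: mult_ac)
  qed simp
  then show thesis using that[of "norm (mat 1 :: complex^'n^'n)" "norm J * K"] K(1) by simp
qed

lemma matrix_exp_sums:
  fixes J :: "complex^'n^'n"
  shows "(\<lambda>k. (1 / fact k) *\<^sub>R matrix_power J k) sums matrix_exp J"
proof -
  obtain C B where CB: "C \<ge> 0" "B \<ge> 0" "\<And>k. norm (matrix_power J k) \<le> C * B ^ k"
    using norm_matrix_power_le[of J] by blast
  have "summable (\<lambda>k. C * (inverse (fact k) * B ^ k))"
    by (intro summable_mult summable_exp)
  then have "summable (\<lambda>k. (1 / fact k) *\<^sub>R matrix_power J k)"
    by (rule summable_comparison_test'[where N = 0]) (use CB(3) in \<open>simp add: field_simps\<close>)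
  then show ?thesis unfolding matrix_exp_def by (rule summable_sums)
qed

text \<open>The derivative of order \<open>k\<close> of \<open>y\<close> is
  \<open>matrix_power J k *v y\<close>, so the Taylor polynomials of \<open>y\<close> at
  \<open>a\<close>, evaluated at \<open>b\<close>, are the partial sums of the exponential series
  applied to \<open>y a\<close>. The integral remainder tends to zero, which identifies
  \<open>y b\<close> without a separate uniqueness argument.\<close>

lemma linear_ode_solution:
  fixes J :: "complex^'n^'n"
  assumes "a \<le> b"
    and deriv: "\<And>s. s \<in> {a..b} \<Longrightarrow> (y has_vector_derivative J *v y s) (at s within {a..b})"
  shows "y b = matrix_exp ((b - a) *\<^sub>R J) *v y a"
proof -
  define D where "D k s = matrix_power J k *v y s" for k s
  define T where "T n = (\<Sum>k<n. ((b - a) ^ k / fact k) *\<^sub>R D k a)" for n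
  have D: "(D k has_vector_derivative D (Suc k) s) (at s within {a..b})" if "s \<in> {a..b}" for k s
  proof -
    \<comment> \<open>Differentiating produces the new factor \<open>J\<close> on the right, whereas
      \<open>matrix_power\<close> adds it on the left.\<close>
    have comm: "matrix_power J k ** J = J ** matrix_power J k"
      by (induction k) (simp_all flip: matrix_mul_assoc)
    show ?thesis
      using bounded_linear.has_vector_derivative[OF matrix_vector_mul_bounded_linear deriv[OF that],
          of "matrix_power J k"]
      unfolding D_def by (simp add: matrix_vector_mul_assoc comm)
  qed
  obtain C B where CB: "C \<ge> 0" "B \<ge> 0" "\<And>k. norm (matrix_power J k) \<le> C * B ^ k"
    using norm_matrix_power_le[of J] by blast
  obtain K where K: "K > 0" "\<And>(M :: complex^'n^'n) v. norm (M *v v) \<le> norm M * norm v * K"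
    using bounded_bilinear.pos_bounded[OF bounded_bilinear_matrix_vector_mult] by blast
  have "continuous_on {a..b} y"
    unfolding continuous_on_eq_continuous_within
    using deriv has_vector_derivative_continuous by blast
  then have "bounded (y ` {a..b})"
    by (intro compact_imp_bounded compact_continuous_image) auto
  then obtain Y where Y: "Y > 0" "\<And>s. s \<in> {a..b} \<Longrightarrow> norm (y s) \<le> Y"
    unfolding bounded_pos by auto
  have D_le: "norm (D k s) \<le> C * B ^ k * Y * K" if "s \<in> {a..b}" for k s
  proof -
    have "norm (D k s) \<le> norm (matrix_power J k) * norm (y s) * K"
      unfolding D_def by (rule K(2))
    also have "\<dots> \<le> C * B ^ k * Y * K"
      using CB K(1) Y(2)[OF that] by (intro mult_right_mono mult_mono) auto
    finally show ?thesis .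
  qed
  \<comment> \<open>Order \<open>Suc n\<close> leaves exponent \<open>n\<close> in the integrand.
    The extra \<open>B\<close> comes from the derivative of order \<open>Suc n\<close>, the extra
    \<open>b - a\<close> from the length of the interval.\<close>
  have remainder: "norm (y b - T (Suc n)) \<le> C * B * Y * K * (b - a) * ((B * (b - a)) ^ n / fact n)" for n
  proof -
    have "((\<lambda>s. ((b - s) ^ (Suc n - 1) / fact (Suc n - 1)) *\<^sub>R D (Suc n) s) has_integral
        y b - (\<Sum>k<Suc n. ((b - a) ^ k / fact k) *\<^sub>R D k a)) {a..b}"
    proof (rule Taylor_has_integral)
      show "D 0 = y" by (simp add: D_def fun_eq_iff)
      show "(D m has_vector_derivative D (Suc m) u) (at u within {a..b})"
        if "a \<le> u" "u \<le> b" for m u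
        using that by (intro D) simp
    qed (use \<open>a \<le> b\<close> in auto)
    then have int: "((\<lambda>s. ((b - s) ^ n / fact n) *\<^sub>R D (Suc n) s) has_integral y b - T (Suc n)) (cbox a b)"
      unfolding T_def by simp
    have "norm (y b - T (Suc n)) \<le> ((b - a) ^ n / fact n * (C * B ^ Suc n * Y * K)) * content (cbox a b)"
    proof (rule has_integral_bound[OF _ int])
      show "0 \<le> (b - a) ^ n / fact n * (C * B ^ Suc n * Y * K)"
        using CB K(1) Y(1) \<open>a \<le> b\<close> by simp
    next
      fix s assume "s \<in> cbox a b"
      then have s: "s \<in> {a..b}" by simp
      have "norm (((b - s) ^ n / fact n) *\<^sub>R D (Suc n) s) = (b - s) ^ n / fact n * norm (D (Suc n) s)"
        using s by simp
      also have "\<dots> \<le> (b - a) ^ n / fact n * (C * B ^ Suc n * Y * K)"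
        using s \<open>a \<le> b\<close> by (intro mult_mono divide_right_mono power_mono D_le) auto
      finally show "norm (((b - s) ^ n / fact n) *\<^sub>R D (Suc n) s) \<le> (b - a) ^ n / fact n * (C * B ^ Suc n * Y * K)" .
    qed
    also have "\<dots> = C * B * Y * K * (b - a) * ((B * (b - a)) ^ n / fact n)"
      using \<open>a \<le> b\<close> by (simp add: power_mult_distrib)
    finally show ?thesis .
  qed
  have "(\<lambda>n. (B * (b - a)) ^ n / fact n) \<longlonglongrightarrow> 0"
    using summable_LIMSEQ_zero[OF summable_exp[of "B * (b - a)"]] by (simp add: field_simps)
  then have "(\<lambda>n. C * B * Y * K * (b - a) * ((B * (b - a)) ^ n / fact n)) \<longlonglongrightarrow> 0"
    by (rule tendsto_mult_right_zero)
  then have "(\<lambda>n. y b - T (Suc n)) \<longlonglongrightarrow> 0"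
    by (rule Lim_null_comparison[rotated]) (use remainder in simp)
  then have "(\<lambda>n. T (Suc n)) \<longlonglongrightarrow> y b"
    by (subst (asm) tendsto_cong[of _ "\<lambda>n. - (T (Suc n) - y b)"])
      (auto simp: Lim_null[of _ "y b"] dest: tendsto_minus)
  moreover have "T \<longlonglongrightarrow> matrix_exp ((b - a) *\<^sub>R J) *v y a"
  proof -
    have "bounded_linear (\<lambda>M :: complex^'n^'n. M *v y a)"
      by (rule bounded_bilinear.bounded_linear_left[OF bounded_bilinear_matrix_vector_mult])
    from bounded_linear.sums[OF this matrix_exp_sums[of "(b - a) *\<^sub>R J"]]
    show ?thesis
      unfolding T_def D_def sums_def
      by (simp add: matrix_power_scaleR bounded_bilinear.scaleR_left[OF bounded_bilinear_matrix_vector_mult])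
  qed
  ultimately show ?thesis
    using LIMSEQ_Suc LIMSEQ_unique by blast
qed

text \<open>From \<open>matrix_inv P ** complex_matrix A = J ** matrix_inv P\<close> the coordinates
  satisfy y' = J y. The equation for \<open>x\<close> is given only on \<open>{a..<b}\<close>, so
  the previous lemma is applied on the closed piece \<open>{a..s}\<close>.\<close>

lemma jordan_coordinates_solution:
  fixes x :: "real \<Rightarrow> real^'n" and A :: "real^'n^'n"
  assumes jd: "jordan_decomposition A P J"
    and deriv: "\<And>s. s \<in> {a..<b} \<Longrightarrow> (x has_vector_derivative A *v x s) (at s within {a..<b})"
    and "s \<in> {a..<b}"
  defines "y \<equiv> \<lambda>s. matrix_inv P *v complex_vector (x s)"
  shows "y s = matrix_exp ((s - a) *\<^sub>R J) *v y a"
proof (rule linear_ode_solution)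
  show "a \<le> s" using assms by simp
next
  fix r assume "r \<in> {a..s}"
  then have "(x has_vector_derivative A *v x r) (at r within {a..s})"
    using \<open>s \<in> {a..<b}\<close> by (intro has_vector_derivative_within_subset[OF deriv]) auto
  then have "(y has_vector_derivative matrix_inv P *v complex_vector (A *v x r)) (at r within {a..s})"
    unfolding y_def
    by (intro bounded_linear.has_vector_derivative[OF matrix_vector_mul_bounded_linear]
        bounded_linear.has_vector_derivative[OF bounded_linear_complex_vector])
  moreover have "matrix_inv P ** complex_matrix A = J ** matrix_inv P"
    using jd unfolding jordan_decomposition_def
    by (metis matrix_inv_left matrix_mul_assoc matrix_mul_lid)
  ultimately show "(y has_vector_derivative J *v y r) (at r within {a..s})"
    by (simp add: y_def complex_vector_mult matrix_vector_mul_assoc)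
qed


section \<open>Switching signals and dwell times\<close>

text \<open>Constancy is given on the open interval only. Right-continuity at \<open>t k\<close>
  supplies a point \<open>r\<close> inside it with \<open>\<sigma> r = \<sigma> (t k)\<close>, which
  fixes the constant.\<close>

lemma switching_signal_interval:
  assumes "switching_signal V \<sigma> t" "s \<in> {t k..<t (Suc k)}"
  shows "\<sigma> s = \<sigma> (t k)"
proof (cases "s = t k")
  case False
  have t: "t 0 = 0" "strict_mono t" using assms(1) by (auto simp: switching_signal_def)
  then have "0 \<le> t k" "t k < t (Suc k)"
    by (metis le0 strict_mono_less_eq, simp add: strict_monoD)
  then have "\<forall>\<^sub>F r in at_right (t k). \<sigma> r = \<sigma> (t k)"
    using assms(1) by (simp add: switching_signal_def)
  moreover have "\<forall>\<^sub>F r in at_right (t k). r \<in> {t k<..<t (Suc k)}"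
    using \<open>t k < t (Suc k)\<close> by (rule eventually_at_right_real)
  ultimately obtain r where "\<sigma> r = \<sigma> (t k)" "r \<in> {t k<..<t (Suc k)}"
    using eventually_happens'[OF trivial_limit_at_right_real] eventually_conj by (metis (mono_tags, lifting))
  moreover have "s \<in> {t k<..<t (Suc k)}" using False assms(2) by auto
  moreover have "\<sigma> constant_on {t k<..<t (Suc k)}"
    using assms(1) by (simp add: switching_signal_def)
  ultimately show ?thesis unfolding constant_on_def by metis
qed simp

lemma switching_interval_exists:
  fixes t :: "nat \<Rightarrow> real"
  assumes "t 0 \<le> s" "filterlim t at_top sequentially"
  obtains k where "s \<in> {t k..<t (Suc k)}"
proof -
  obtain n where "s < t n"
    using assms(2) by (metis eventually_happens filterlim_at_top_dense trivial_limit_sequentially)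
  moreover have "\<not> s < t 0" using assms(1) by simp
  ultimately obtain k where "\<forall>i\<le>k. \<not> s < t i" "s < t (Suc k)"
    using ex_least_nat_less[of "\<lambda>n. s < t n" n] by blast
  then show thesis using that by (auto simp: not_less)
qed

text \<open>The suprema are over sets bounded above, as \<open>ln z \<le> z\<close> for all \<open>z \<ge> 0\<close> (the junk value
  \<open>ln 0 = 0\<close> included).\<close>

lemma le_Max_SUP_ln:
  fixes \<M> :: "(real^'n^'n) set" and P :: "'p \<Rightarrow> complex^'n^'n"
  assumes "finite F" "(p, q) \<in> F" "bounded \<M>" "M \<in> \<M>" "c p > 0" "r p > 0"
  shows "ln (c p * spectral_norm (matrix_inv (P q) ** complex_matrix M ** P p)) / r p
    \<le> (MAX (p, q) \<in> F. SUP M\<in>\<M>.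
         ln (c p * spectral_norm (matrix_inv (P q) ** complex_matrix M ** P p)) / r p)"
    (is "?f p q M \<le> Max (?g ` F)")
proof -
  obtain B where B: "\<And>M. M \<in> \<M> \<Longrightarrow> spectral_norm (matrix_inv (P q) ** complex_matrix M ** P p) \<le> B"
    using bounded_spectral_norm_conjugate[OF assms(3)] by blast
  have ln_le: "ln z \<le> z" if "z \<ge> 0" for z :: real
    using that ln_bound[of z] by (cases "z = 0") auto
  have "?f p q N \<le> c p * B / r p" if "N \<in> \<M>" for N
  proof (rule divide_right_mono)
    have "ln (c p * spectral_norm (matrix_inv (P q) ** complex_matrix N ** P p))
      \<le> c p * spectral_norm (matrix_inv (P q) ** complex_matrix N ** P p)"
      using assms(5) by (intro ln_le) simp
    also have "\<dots> \<le> c p * B" using assms(5) B[OF that] by simp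
    finally show "ln (c p * spectral_norm (matrix_inv (P q) ** complex_matrix N ** P p)) \<le> c p * B" .
  qed (use assms(6) in simp)
  then have "bdd_above (?f p q ` \<M>)"
    by (intro bdd_aboveI2)
  then have "?f p q M \<le> (SUP M\<in>\<M>. ?f p q M)"
    using assms(4) by (rule cSUP_upper2) simp
  also have "\<dots> \<le> Max (?g ` F)"
    using assms(1,2) by (intro Max_ge) (auto intro!: image_eqI)
  finally show ?thesis .
qed

section \<open>Growth and contraction over one switching interval\<close>

lemma mult_exp_le_one:
  fixes a z :: real
  assumes "a \<ge> 0" "ln a \<le> - z"
  shows "a * exp z \<le> 1"
\<comment> \<open>For \<open>a = 0\<close> the product vanishes, whatever the value of
  \<open>ln 0\<close>; otherwise the logarithm can be inverted.\<close>
proof (cases "a = 0")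
  case False
  with assms have "a \<le> exp (- z)" by (metis exp_le_cancel_iff exp_ln less_eq_real_def)
  then show ?thesis by (simp add: exp_minus field_simps)
qed simp

text \<open>A real rate \<open>r\<close> of either sign treats decay and growth together. The point
  \<open>s = a\<close> is left out because the exponential is bounded for positive times
  only.\<close>

lemma jordan_coordinates_estimate:
  fixes x :: "real \<Rightarrow> real^'n" and A :: "real^'n^'n"
  assumes jd: "jordan_decomposition A P J"
    and deriv: "\<And>s. s \<in> {a..<b} \<Longrightarrow> (x has_vector_derivative A *v x s) (at s within {a..<b})"
    and J: "\<And>s. s > 0 \<Longrightarrow> spectral_norm (matrix_exp (s *\<^sub>R J)) \<le> c * exp (r * s)"
    and "s \<in> {a<..<b}"
  defines "y \<equiv> \<lambda>s. matrix_inv P *v complex_vector (x s)"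
  shows "norm (y s) \<le> c * exp (r * (s - a)) * norm (y a)"
proof -
  have "y s = matrix_exp ((s - a) *\<^sub>R J) *v y a"
    unfolding y_def by (rule jordan_coordinates_solution[OF jd deriv]) (use \<open>s \<in> {a<..<b}\<close> in auto)
  then have "norm (y s) \<le> spectral_norm (matrix_exp ((s - a) *\<^sub>R J)) * norm (y a)"
    using norm_matrix_vector_le by metis
  also have "\<dots> \<le> c * exp (r * (s - a)) * norm (y a)"
    using J[of "s - a"] \<open>s \<in> {a<..<b}\<close> by (intro mult_right_mono) auto
  finally show ?thesis .
qed

text \<open>An impulse acts on the left limit rather than on a value of \<open>x\<close>, so the
  interior estimate is carried to \<open>b\<close> by letting s increase to it.\<close>

lemma jordan_coordinates_estimate_left_limit:
  fixes x :: "real \<Rightarrow> real^'n" and A :: "real^'n^'n"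
  assumes jd: "jordan_decomposition A P J"
    and deriv: "\<And>s. s \<in> {a..<b} \<Longrightarrow> (x has_vector_derivative A *v x s) (at s within {a..<b})"
    and J: "\<And>s. s > 0 \<Longrightarrow> spectral_norm (matrix_exp (s *\<^sub>R J)) \<le> c * exp (r * s)"
    and "a < b" "(x \<longlongrightarrow> l) (at_left b)"
  shows "norm (matrix_inv P *v complex_vector l)
    \<le> c * exp (r * (b - a)) * norm (matrix_inv P *v complex_vector (x a))"
proof (rule tendsto_le)
  show "((\<lambda>s. c * exp (r * (s - a)) * norm (matrix_inv P *v complex_vector (x a)))
      \<longlongrightarrow> c * exp (r * (b - a)) * norm (matrix_inv P *v complex_vector (x a))) (at_left b)"
    by (intro tendsto_intros)
  show "((\<lambda>s. norm (matrix_inv P *v complex_vector (x s)))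
      \<longlongrightarrow> norm (matrix_inv P *v complex_vector l)) (at_left b)"
    by (intro tendsto_norm bounded_linear.tendsto[OF matrix_vector_mul_bounded_linear]
        bounded_linear.tendsto[OF bounded_linear_complex_vector] assms)
  show "\<forall>\<^sub>F s in at_left b. norm (matrix_inv P *v complex_vector (x s))
      \<le> c * exp (r * (s - a)) * norm (matrix_inv P *v complex_vector (x a))"
    using eventually_at_left_real[OF \<open>a < b\<close>]
    by eventually_elim (rule jordan_coordinates_estimate[OF jd deriv J])
qed simp

section \<open>Stability under arbitrary impulses\<close>

theorem theorem3p12:
  fixes V :: "'p set" and A :: "'p \<Rightarrow> real^'n^'n"
    and Q :: "'q set" and I :: "'q \<Rightarrow> real^'n^'n"
    and E :: "('p \<times> 'p) set"
    and P J :: "'p \<Rightarrow> complex^'n^'n"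
    and c lam mu :: "'p \<Rightarrow> real"
  assumes "finite V"
    and "\<And>p. p \<in> V \<Longrightarrow> stable_matrix (A p) \<or> unstable_matrix (A p)"
    and "I ` Q \<noteq> {}" and "compact (I ` Q)" and "\<And>q. q \<in> Q \<Longrightarrow> I q \<noteq> 0"
    and "subsystem_graph V E" and "acyclic (unstable_edges A E)"
    and "\<And>p. p \<in> V \<Longrightarrow> jordan_decomposition (A p) (P p) (J p)"
    and "\<And>p. p \<in> V \<Longrightarrow> c p > 0"
    and "\<And>p. p \<in> V \<Longrightarrow> stable_matrix (A p) \<Longrightarrow> lam p > 0"
    and "\<And>p. p \<in> V \<Longrightarrow> unstable_matrix (A p) \<Longrightarrow> mu p > 0"
    and "\<And>p s. p \<in> V \<Longrightarrow> stable_matrix (A p) \<Longrightarrow> s > 0 \<Longrightarrow>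
           spectral_norm (matrix_exp (s *\<^sub>R J p)) \<le> c p * exp (- lam p * s)"
    and "\<And>p s. p \<in> V \<Longrightarrow> unstable_matrix (A p) \<Longrightarrow> s > 0 \<Longrightarrow>
           spectral_norm (matrix_exp (s *\<^sub>R J p)) \<le> c p * exp (mu p * s)"
  shows "\<forall>(\<sigma>, t) \<in> dwell_flee_signals V A E
             (tau_bound A E (I ` Q) P c lam) (eta_bound A E (I ` Q) P c mu).
           \<forall>\<omega>. (\<forall>k\<ge>1. \<omega> (t k) \<in> Q) \<longrightarrow> impulsive_stable A I \<sigma> t \<omega>"
proof (intro ballI, clarify)
  note finV = assms(1) and dich = assms(2) and graph = assms(6) and jd = assms(8)
    and c_pos = assms(9) and lam_pos = assms(10) and mu_pos = assms(11)
  define \<tau> where "\<tau> = tau_bound A E (I ` Q) P c lam"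
  define \<eta> where "\<eta> = eta_bound A E (I ` Q) P c mu"
  fix \<sigma> :: "real \<Rightarrow> 'p" and t and \<omega> :: "real \<Rightarrow> 'q"
  assume "(\<sigma>, t) \<in> dwell_flee_signals V A E (tau_bound A E (I ` Q) P c lam) (eta_bound A E (I ` Q) P c mu)"
  then have sw: "switching_signal V \<sigma> t" and "admissible E \<sigma> t"
    and dwell: "\<forall>k\<ge>1. (stable_matrix (A (\<sigma> (t (k - 1)))) \<longrightarrow> t k - t (k - 1) \<ge> \<tau>) \<and>
      (unstable_matrix (A (\<sigma> (t (k - 1)))) \<longrightarrow> t k - t (k - 1) \<le> \<eta>)"
    unfolding dwell_flee_signals_def \<tau>_def \<eta>_def by auto
  assume \<omega>: "\<forall>k\<ge>1. \<omega> (t k) \<in> Q"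
  have t: "t 0 = 0" "strict_mono t" "filterlim t at_top sequentially"
    using sw by (auto simp: switching_signal_def)
  have t_less: "t k < t (Suc k)" for k using t(2) by (simp add: strict_monoD)
  have "0 \<le> t k" for k using t by (metis le0 strict_mono_less_eq)
  then have \<sigma>V: "\<sigma> (t k) \<in> V" for k using sw by (simp add: switching_signal_def)
  have edge: "(\<sigma> (t k), \<sigma> (t (Suc k))) \<in> E" for k
    using \<open>admissible E \<sigma> t\<close> unfolding admissible_def by (metis diff_Suc_1 le_add1 plus_1_eq_Suc)
  have dwell_stable: "t (Suc k) - t k \<ge> \<tau>" if "stable_matrix (A (\<sigma> (t k)))" for k
    using dwell[rule_format, of "Suc k"] that by simp
  have flee_unstable: "t (Suc k) - t k \<le> \<eta>" if "unstable_matrix (A (\<sigma> (t k)))" for k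
    using dwell[rule_format, of "Suc k"] that by simp
  have "finite E" using graph finV unfolding subsystem_graph_def by (meson finite_SigmaI finite_subset)
  then have fin: "finite (stable_edges A E)" "finite (unstable_edges A E)"
    by (auto intro: finite_subset simp: stable_edges_def unstable_edges_def)

  \<comment> \<open>One signed rate merges the stable and unstable cases; \<open>S p q M\<close> is
    the norm of the impulse \<open>M\<close> read in the coordinates of \<open>p\<close> before and
    of \<open>q\<close> after the switch.\<close>
  define r where "r p = (if stable_matrix (A p) then - lam p else mu p)" for p
  define S where "S p q M = spectral_norm (matrix_inv (P q) ** complex_matrix M ** P p)" for p q M
  have J: "spectral_norm (matrix_exp (s *\<^sub>R J p)) \<le> c p * exp (r p * s)" if "p \<in> V" "s > 0" for p s
    using assms(12)[OF that(1) _ that(2)] assms(13)[OF that(1) _ that(2)] dich[OF that(1)]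
    by (auto simp: r_def)
  \<comment> \<open>Flow over a whole interval followed by an impulse is non-expanding. After taking
    logarithms this is exactly the dwell bound for stable \<open>p\<close> and the flee bound for
    unstable \<open>p\<close>.\<close>
  have jump: "c p * S p q (I w) * exp (r p * (t (Suc k) - t k)) \<le> 1"
    if p: "p = \<sigma> (t k)" and q: "q = \<sigma> (t (Suc k))" and "w \<in> Q" for k p q w
  proof (rule mult_exp_le_one)
    have "p \<in> V" using \<sigma>V p by simp
    note c_pos = c_pos[OF this]
    show "0 \<le> c p * S p q (I w)" using c_pos by (simp add: S_def)
    have "bounded (I ` Q)" "I w \<in> I ` Q" using assms(4) \<open>w \<in> Q\<close> by (auto intro: compact_imp_bounded)
    note Max = le_Max_SUP_ln[where p = p and q = q and P = P and c = c, OF _ _ this c_pos]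
    show "ln (c p * S p q (I w)) \<le> - (r p * (t (Suc k) - t k))"
    proof (cases "stable_matrix (A p)")
      case True
      \<comment> \<open>The traversed edge itself belongs to the edge set, so the maximum defining
        the bound is over a nonempty set whenever it is invoked.\<close>
      have "ln (c p * S p q (I w)) / lam p \<le> \<tau>"
        unfolding S_def \<tau>_def tau_bound_def
        by (rule Max[OF fin(1)]) (use edge True p q lam_pos \<sigma>V in \<open>auto simp: stable_edges_def\<close>)
      also have "\<tau> \<le> t (Suc k) - t k" using dwell_stable[of k] True p by simp
      finally show ?thesis using True lam_pos[OF \<open>p \<in> V\<close> True] by (simp add: r_def field_simps)
    next
      case False
      then have un: "unstable_matrix (A p)" using dich \<open>p \<in> V\<close> by blast
      \<comment> \<open>\<open>eta_bound\<close> is minus a maximum, hence the maximum is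
        \<open>- \<eta>\<close>, and a short stay makes the required inequality stronger.\<close>
      have "ln (c p * S p q (I w)) / mu p \<le> - \<eta>"
        unfolding S_def \<eta>_def eta_bound_def minus_minus
        by (rule Max[OF fin(2)]) (use edge un p q mu_pos \<sigma>V in \<open>auto simp: unstable_edges_def\<close>)
      also have "- \<eta> \<le> - (t (Suc k) - t k)" using flee_unstable[of k] un p by simp
      finally show ?thesis using False mu_pos[OF \<open>p \<in> V\<close> un] by (simp add: r_def field_simps)
    qed
  qed

  \<comment> \<open>Sums over \<open>V\<close> bound each of their nonnegative terms. The absolute
    value lets the same expression cover stable subsystems, whose exponents are nonpositive; the
    summand 1 gives \<open>1 \<le> K\<close>, needed at the switching times themselves.\<close>
  define K where "K = 1 + (\<Sum>p\<in>V. c p * exp \<bar>mu p * \<eta>\<bar>)"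
  define N where "N = (\<Sum>p\<in>V. spectral_norm (P p))"
  define N' where "N' = (\<Sum>p\<in>V. spectral_norm (matrix_inv (P p)))"
  have N: "spectral_norm (P p) \<le> N" "spectral_norm (matrix_inv (P p)) \<le> N'" if "p \<in> V" for p
    unfolding N_def N'_def using finV that by (auto intro: member_le_sum)
  have pos: "0 \<le> N" "0 \<le> N'" "1 \<le> K"
    unfolding N_def N'_def K_def using c_pos by (auto intro!: sum_nonneg simp: less_imp_le)
  have growth: "c (\<sigma> (t k)) * exp (r (\<sigma> (t k)) * (s - t k)) \<le> K" if "s \<in> {t k<..<t (Suc k)}" for k s
  proof -
    let ?p = "\<sigma> (t k)"
    have "r ?p * (s - t k) \<le> \<bar>mu ?p * \<eta>\<bar>"
    proof (cases "stable_matrix (A ?p)")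
      case True
      then have "lam ?p * (s - t k) \<ge> 0" using lam_pos[OF \<sigma>V True] that by simp
      then show ?thesis using True by (simp add: r_def)
    next
      case False
      then have un: "unstable_matrix (A ?p)" using dich \<sigma>V by blast
      have "mu ?p * (s - t k) \<le> mu ?p * \<eta>"
        using mu_pos[OF \<sigma>V un] flee_unstable[OF un] that by (intro mult_left_mono) auto
      then show ?thesis using False by (simp add: r_def)
    qed
    then have "c ?p * exp (r ?p * (s - t k)) \<le> c ?p * exp \<bar>mu ?p * \<eta>\<bar>"
      using c_pos[OF \<sigma>V] by simp
    also have "\<dots> \<le> (\<Sum>p\<in>V. c p * exp \<bar>mu p * \<eta>\<bar>)"
      using finV \<sigma>V c_pos by (intro member_le_sum) (auto simp: less_imp_le)
    finally show ?thesis by (simp add: K_def)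
  qed

  have bound: "norm (x s) \<le> N * (K * N') * norm (x 0)"
    if sol: "impulsive_solution A I \<sigma> t \<omega> x" and "s > 0" for x s
  proof -
    \<comment> \<open>The index \<open>k\<close> fixes the coordinate system independently of
      \<open>s\<close>, so \<open>y k\<close> and \<open>y (Suc k)\<close> describe the state around
      \<open>t (Suc k)\<close> before and after the change of coordinates.\<close>
    define y where "y k s = matrix_inv (P (\<sigma> (t k))) *v complex_vector (x s)" for k s
    have deriv: "(x has_vector_derivative A (\<sigma> (t k)) *v x s) (at s within {t k..<t (Suc k)})"
      if "s \<in> {t k..<t (Suc k)}" for k s
      using sol[unfolded impulsive_solution_def, THEN conjunct1, rule_format, of "Suc k" s] that
        switching_signal_interval[OF sw that] by simp
    have P_inv: "P (\<sigma> (t k)) ** matrix_inv (P (\<sigma> (t k))) = mat 1" for k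
      using jd[OF \<sigma>V] by (simp add: jordan_decomposition_def matrix_inv_right)
    have x_y: "complex_vector (x s) = P (\<sigma> (t k)) *v y k s" for k s
      by (simp add: y_def matrix_vector_mul_assoc P_inv)
    have step: "norm (y (Suc k) (t (Suc k))) \<le> norm (y k (t k))" for k
    proof -
      let ?p = "\<sigma> (t k)" and ?q = "\<sigma> (t (Suc k))" and ?M = "I (\<omega> (t (Suc k)))"
      obtain l where l: "(x \<longlongrightarrow> l) (at_left (t (Suc k)))" "x (t (Suc k)) = ?M *v l"
        using sol unfolding impulsive_solution_def by (metis le_add1 plus_1_eq_Suc)
      define z where "z = matrix_inv (P ?p) *v complex_vector l"
      have z: "norm z \<le> c ?p * exp (r ?p * (t (Suc k) - t k)) * norm (y k (t k))"
        unfolding z_def y_def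
        by (rule jordan_coordinates_estimate_left_limit[OF jd[OF \<sigma>V] deriv J[OF \<sigma>V] t_less l(1)])
      \<comment> \<open>Inserting \<open>P ?p ** matrix_inv (P ?p) = mat 1\<close> between the
        impulse and \<open>l\<close> exhibits the matrix measured by \<open>S\<close>.\<close>
      have "y (Suc k) (t (Suc k)) = (matrix_inv (P ?q) ** complex_matrix ?M ** P ?p) *v z"
        unfolding y_def z_def l(2) complex_vector_mult
        by (metis P_inv matrix_vector_mul_assoc matrix_vector_mul_lid)
      then have "norm (y (Suc k) (t (Suc k))) \<le> S ?p ?q ?M * norm z"
        unfolding S_def by (metis norm_matrix_vector_le)
      also have "\<dots> \<le> S ?p ?q ?M * (c ?p * exp (r ?p * (t (Suc k) - t k)) * norm (y k (t k)))"
        by (rule mult_left_mono[OF z]) (simp add: S_def)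
      also have "\<dots> = (c ?p * S ?p ?q ?M * exp (r ?p * (t (Suc k) - t k))) * norm (y k (t k))"
        by (simp add: mult_ac)
      also have "\<dots> \<le> 1 * norm (y k (t k))"
        by (intro mult_right_mono jump) (use \<omega> in auto)
      finally show ?thesis by simp
    qed
    have y_le: "norm (y k (t k)) \<le> norm (y 0 0)" for k
      using step by (induction k) (auto simp: t(1) intro: order_trans)
    obtain k where k: "s \<in> {t k..<t (Suc k)}"
      using switching_interval_exists[of t s] \<open>s > 0\<close> t by auto
    have "norm (y k s) \<le> K * norm (y k (t k))"
    \<comment> \<open>The flow estimate excludes the left endpoint, where \<open>1 \<le> K\<close>
      suffices.\<close>
    proof (cases "s = t k")
      case True
      then show ?thesis using pos(3) by (simp add: mult_le_cancel_right1)
    next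
      case False
      then have s: "s \<in> {t k<..<t (Suc k)}" using k by auto
      have "norm (y k s) \<le> c (\<sigma> (t k)) * exp (r (\<sigma> (t k)) * (s - t k)) * norm (y k (t k))"
        unfolding y_def by (rule jordan_coordinates_estimate[OF jd[OF \<sigma>V] deriv J[OF \<sigma>V] s])
      also have "\<dots> \<le> K * norm (y k (t k))" by (intro mult_right_mono growth s) simp
      finally show ?thesis .
    qed
    also have "\<dots> \<le> K * norm (y 0 0)" using y_le pos(3) by (intro mult_left_mono) auto
    also have "norm (y 0 0) \<le> N' * norm (x 0)"
      using norm_matrix_vector_le[of "matrix_inv (P (\<sigma> (t 0)))" "complex_vector (x 0)"]
        mult_right_mono[OF N(2)[OF \<sigma>V[of 0]], of "norm (x 0)"]
      by (simp add: y_def)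
    finally have y: "norm (y k s) \<le> K * (N' * norm (x 0))" using pos(3) by simp
    have "norm (x s) = norm (P (\<sigma> (t k)) *v y k s)" by (metis norm_complex_vector x_y)
    also have "\<dots> \<le> spectral_norm (P (\<sigma> (t k))) * norm (y k s)" by (rule norm_matrix_vector_le)
    also have "\<dots> \<le> N * (K * (N' * norm (x 0)))"
      by (intro mult_mono N(1) \<sigma>V y pos) auto
    finally show ?thesis by (simp add: mult_ac)
  qed

  \<comment> \<open>The added 1 makes \<open>L\<close> positive, so \<open>\<epsilon> / L\<close> is
    an admissible choice of delta, the same for all solutions.\<close>
  define L where "L = N * (K * N') + 1"
  have "L > 0" using pos by (simp add: L_def add_nonneg_pos)
  show "impulsive_stable A I \<sigma> t \<omega>"
    unfolding impulsive_stable_def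
  proof (intro allI impI)
    fix \<epsilon> :: real assume "\<epsilon> > 0"
    show "\<exists>\<delta>>0. \<forall>x. impulsive_solution A I \<sigma> t \<omega> x \<longrightarrow> norm (x 0) < \<delta> \<longrightarrow> (\<forall>s>0. norm (x s) < \<epsilon>)"
    proof (intro exI[of _ "\<epsilon> / L"] conjI allI impI)
      show "\<epsilon> / L > 0" using \<open>\<epsilon> > 0\<close> \<open>L > 0\<close> by simp
    next
      fix x s assume x: "impulsive_solution A I \<sigma> t \<omega> x" "norm (x 0) < \<epsilon> / L" and "(s :: real) > 0"
      have "norm (x s) \<le> N * (K * N') * norm (x 0)" by (rule bound[OF x(1) \<open>s > 0\<close>])
      also have "\<dots> \<le> L * norm (x 0)" by (intro mult_right_mono) (auto simp: L_def)
      also have "\<dots> < \<epsilon>" using x(2) \<open>L > 0\<close> by (simp add: field_simps)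
      finally show "norm (x s) < \<epsilon>" .
    qed
  qed
qed

end
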